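(* Let $P(q)=(q^4;q^4)_\infty\, S(q)$, where $S(q)=\sum_{m\ge 0}\frac{(q;q^2)_m^2\,q^{2m}}{(-q^2;q^2)_m}$, regarded as a formal power series $P(q)=\sum_{n\ge 0}A(n)q^n$. Then $$P(q)\big|_{S_{8,4}}=0,$$ that is, $A(n)=0$ for every integer $n\ge 0$ with $n\equiv 4\pmod 8$.
   Context: Notation: $(a;q)_0:=1$, $(a;q)_n:=\prod_{j=0}^{n-1}(1-aq^j)$, $(a;q)_\infty:=\prod_{j=0}^{\infty}(1-aq^j)$ for $|q|<1$ (or as formal power series in $q$). Thus $(q;q^2)_m=\prod_{j=0}^{m-1}(1-q^{2j+1})$, $(-q^2;q^2)_m=\prod_{j=1}^{m}(1+q^{2j})$ and $(q^4;q^4)_\infty=\prod_{j\ge 1}(1-q^{4j})$. For a formal power series $P(q)=\sum_{n\ge 0}A(n)q^n$ and integers $N\ge 1$, $0\le r<N$, the sieve operator is $P(q)\big|_{S_{N,r}}=\sum_{n\ge 0,\ n\equiv r\ (\mathrm{mod}\ N)}A(n)q^n$. *)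

theory Defs
  imports "HOL-Analysis.Analysis" "HOL-Computational_Algebra.Formal_Power_Series"
begin

text \<open>
  All limits of formal power series below (\<^const>\<open>suminf\<close>, \<^const>\<open>prodinf\<close>) refer to the
  library topology on \<^typ>\<open>'a fps\<close>, which is the \<open>X\<close>-adic one
  (see \<open>dist_fps_def\<close>).
\<close>

definition q_pochhammer :: "'a::comm_ring_1 \<Rightarrow> 'a \<Rightarrow> nat \<Rightarrow> 'a" where
  "q_pochhammer a q n = (\<Prod>j<n. 1 - a * q ^ j)"

definition q_pochhammer_inf :: "'a::{comm_ring_1, t2_space} \<Rightarrow> 'a \<Rightarrow> 'a" where
  "q_pochhammer_inf a q = (\<Prod>j. 1 - a * q ^ j)"

definition sieve :: "nat \<Rightarrow> nat \<Rightarrow> 'a::zero fps \<Rightarrow> 'a fps" where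
  "sieve N r P = Abs_fps (\<lambda>n. if n mod N = r mod N then fps_nth P n else 0)"

definition S_term :: "nat \<Rightarrow> complex fps" where
  "S_term m = q_pochhammer fps_X (fps_X\<^sup>2) m ^ 2 * fps_X ^ (2 * m)
                / q_pochhammer (- (fps_X\<^sup>2)) (fps_X\<^sup>2) m"

definition S_series :: "complex fps" where
  "S_series = (\<Sum>m. S_term m)"

definition P_series :: "complex fps" where
  "P_series = q_pochhammer_inf (fps_X ^ 4) (fps_X ^ 4) * S_series"


text \<open>
  The definitions of \<^const>\<open>S_series\<close> and \<^const>\<open>P_series\<close> are meaningful: the denominators are
  units, and the sum and the product converge.
\<close>

lemma q_pochhammer_denominator_unit:
  "fps_nth (q_pochhammer (- (fps_X\<^sup>2)) (fps_X\<^sup>2 :: complex fps) m) 0 = 1"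
  unfolding q_pochhammer_def by (induction m) simp_all

lemma S_term_nth_eq_0:
  assumes "n < 2 * m"
  shows "fps_nth (S_term m) n = 0"
proof -
  have "S_term m = fps_X ^ (2 * m) * (q_pochhammer fps_X (fps_X\<^sup>2) m ^ 2 *
          inverse (q_pochhammer (- (fps_X\<^sup>2)) (fps_X\<^sup>2) m))"
    using q_pochhammer_denominator_unit[of m]
    by (simp add: S_term_def fps_divide_unit mult_ac)
  then show ?thesis
    using assms by (simp add: fps_X_power_mult_nth)
qed

lemma S_term_sums: "S_term sums S_series"
proof -
  have "(\<lambda>k. \<Sum>m<k. S_term m) \<longlonglongrightarrow> Abs_fps (\<lambda>n. \<Sum>m\<le>n. fps_nth (S_term m) n)"
  proof (rule tendsto_fpsI)
    fix n
    have "fps_nth (\<Sum>m<k. S_term m) n = (\<Sum>m\<le>n. fps_nth (S_term m) n)" if "k > n" for k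
      unfolding fps_sum_nth
      by (rule sum.mono_neutral_right) (use that in \<open>auto intro!: S_term_nth_eq_0\<close>)
    then show "\<forall>\<^sub>F k in sequentially. fps_nth (\<Sum>m<k. S_term m) n =
        fps_nth (Abs_fps (\<lambda>n. \<Sum>m\<le>n. fps_nth (S_term m) n)) n"
      by (auto simp: eventually_at_top_dense intro: exI[of _ n])
  qed
  then show ?thesis
    unfolding S_series_def by (intro summable_sums) (auto simp: summable_def sums_def)
qed

lemma has_prod_q_pochhammer_inf:
  "(\<lambda>j. 1 - fps_X ^ 4 * (fps_X ^ 4) ^ j) has_prod
     q_pochhammer_inf (fps_X ^ 4) (fps_X ^ 4 :: complex fps)"
proof -
  let ?f = "\<lambda>j. 1 - fps_X ^ 4 * (fps_X ^ 4) ^ j :: complex fps"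
  let ?p = "\<lambda>k. \<Prod>j\<le>k. ?f j"
  have f: "?f j = 1 - fps_X ^ (4 * Suc j)" for j
    by (simp only: power_mult power_Suc)
  have step: "fps_nth (?p (Suc k)) n = fps_nth (?p k) n" if "k \<ge> n" for k n
  proof -
    have "?p (Suc k) = ?p k * (1 - fps_X ^ (4 * Suc (Suc k)))"
      by (simp only: prod.atMost_Suc f)
    also have "\<dots> = ?p k - fps_X ^ (4 * Suc (Suc k)) * ?p k"
      by (simp only: right_diff_distrib mult_1_right mult.commute[of "fps_X ^ (4 * Suc (Suc k))"])
    finally have "fps_nth (?p (Suc k)) n = fps_nth (?p k) n -
        fps_nth (fps_X ^ (4 * Suc (Suc k)) * ?p k) n"
      by (simp only: fps_sub_nth)
    moreover have "n < 4 * Suc (Suc k)"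
      using that by simp
    ultimately show ?thesis
      by (simp only: fps_X_power_mult_nth if_True diff_0_right)
  qed
  have const: "fps_nth (?p k) n = fps_nth (?p n) n" if "k \<ge> n" for k n
    using that by (induction k rule: dec_induct) (simp_all only: step)
  have lim: "?p \<longlonglongrightarrow> Abs_fps (\<lambda>n. fps_nth (?p n) n)"
  proof (rule tendsto_fpsI)
    fix n
    show "\<forall>\<^sub>F k in sequentially. fps_nth (?p k) n = fps_nth (Abs_fps (\<lambda>n. fps_nth (?p n) n)) n"
      unfolding fps_nth_Abs_fps using const eventually_ge_at_top by (rule eventually_mono[rotated])
  qed
  have "?p 0 = 1 - fps_X ^ (4 * Suc 0)"
    by (simp only: atMost_0 prod.insert prod.empty finite.emptyI empty_iff not_False_eq_True
        mult_1_right f)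
  then have "fps_nth (Abs_fps (\<lambda>n. fps_nth (?p n) n)) 0 = 1"
    by (simp only: fps_nth_Abs_fps) simp
  then have "Abs_fps (\<lambda>n. fps_nth (?p n) n) \<noteq> 0"
    by (rule contrapos_pn) (simp only: fps_zero_nth zero_neq_one not_False_eq_True)
  with lim have "raw_has_prod ?f 0 (Abs_fps (\<lambda>n. fps_nth (?p n) n))"
    unfolding raw_has_prod_def add_0_right by blast
  then have "?f has_prod Abs_fps (\<lambda>n. fps_nth (?p n) n)"
    unfolding has_prod_def by (rule disjI1)
  moreover from this have "Abs_fps (\<lambda>n. fps_nth (?p n) n) = q_pochhammer_inf (fps_X ^ 4) (fps_X ^ 4)"
    unfolding q_pochhammer_inf_def by (rule has_prod_unique)
  ultimately show ?thesis
    by (rule subst[rotated])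
qed

end

theory Submission
  imports Defs
begin

text \<open>
  Write \<open>Q = q\<^sup>2\<close>. The finite form of Jacobi's triple product expands the numerator of the
  \<open>m\<close>-th term of the series as
  \<open>(q;Q)\<^sub>m\<^sup>2 = \<Sum>\<^bsub>\<bar>k\<bar>\<le>m\<^esub> (-1)\<^sup>k q^(k\<^sup>2) [2m, m+k]\<^sub>Q\<close>
  (lemma \<open>finite_theta_expansion\<close>). Exchanging the two summations turns the product \<open>P\<close> of the
  theorem into
  \<open>P(q) = \<Sum>\<^bsub>k\<in>\<int>\<^esub> (-1)\<^sup>k q^(k\<^sup>2) G\<^bsub>\<bar>k\<bar>\<^esub>\<close> with
  \<open>G\<^sub>k = (Q\<^sup>2;Q\<^sup>2)\<^sub>\<infinity> \<Sum>\<^sub>m [2m, m+k]\<^sub>Q Q\<^sup>m / (-Q;Q)\<^sub>m\<close>,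
  which is lemma \<open>P_series_nth\<close>; \<open>G\<^sub>k\<close> is \<open>gamma_row k\<close>.

  The heart of the matter is that \<open>G\<^sub>k\<close> is very sparse. A telescoping sum in \<open>m\<close>
  (lemma \<open>gamma_partial_recurrence\<close>) yields
  \<open>G\<^sub>k = Q^k (1 + Q^(k+1)) - Q^(3k+3) G\<^bsub>k+2\<^esub>\<close>, and iterating this shows that \<open>G\<^sub>k\<close> is the
  false theta series
  \<open>\<Sum>\<^bsub>r\<ge>0\<^esub> (-1)^r Q^((3r+1)k + 3r\<^sup>2 + 2r) (1 + Q^(k+2r+1))\<close>.
  Thus \<open>P\<close> is a Hecke-type double sum, and no cancellation is needed: no exponent in it is
  \<open>4\<close> modulo \<open>8\<close>. For odd \<open>k\<close> all exponents are odd, as \<open>G\<^sub>k\<close> is a series in \<open>q\<^sup>2\<close>.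
  For even \<open>k\<close> the exponents of \<open>q^(k\<^sup>2) G\<^sub>k\<close> are divisible by \<open>8\<close> or congruent to \<open>2\<close>
  modulo \<open>4\<close>. The recurrence for \<open>G\<^sub>k\<close> proves both facts by induction on the exponent, without
  the closed form (lemma \<open>hecke_row_nth_eq_0\<close>).
\<close>

section \<open>Gaussian binomial coefficients\<close>

lemma q_pochhammer_0 [simp]: "q_pochhammer a q 0 = 1"
  by (simp add: q_pochhammer_def)

lemma q_pochhammer_Suc: "q_pochhammer a q (Suc n) = q_pochhammer a q n * (1 - a * q ^ n)"
  by (simp add: q_pochhammer_def)

text \<open>
  The recursive form makes sense in every commutative ring, including at roots of unity, where
  the quotient of \<open>q\<close>-Pochhammer symbols is not available.
\<close>
fun qbinom :: "'a::comm_ring_1 \<Rightarrow> nat \<Rightarrow> nat \<Rightarrow> 'a" where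
  "qbinom q n 0 = 1"
| "qbinom q 0 (Suc k) = 0"
| "qbinom q (Suc n) (Suc k) = qbinom q n k + q ^ Suc k * qbinom q n (Suc k)"

lemma qbinom_eq_0: "n < k \<Longrightarrow> qbinom q n k = 0"
  by (induction q n k rule: qbinom.induct) auto

lemma qbinom_self [simp]: "qbinom q n n = 1"
  by (induction n) (auto simp: qbinom_eq_0)

lemma qbinom_q_pochhammer:
  "qbinom q (n + k) k * q_pochhammer q q n * q_pochhammer q q k = q_pochhammer q q (n + k)"
proof (induction k arbitrary: n)
  case (Suc k)
  note IH = Suc.IH
  show ?case
  proof (induction n)
    case (Suc n)
    have "qbinom q (Suc n + Suc k) (Suc k) * q_pochhammer q q (Suc n) * q_pochhammer q q (Suc k)
        = (qbinom q (Suc n + k) k * q_pochhammer q q (Suc n) * q_pochhammer q q k) * (1 - q * q ^ k)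
        + q ^ Suc k * (1 - q * q ^ n)
          * (qbinom q (n + Suc k) (Suc k) * q_pochhammer q q n * q_pochhammer q q (Suc k))"
      by (simp add: q_pochhammer_Suc algebra_simps)
    also have "\<dots> = q_pochhammer q q (Suc (n + k)) * (1 - q * q ^ k)
        + q ^ Suc k * (1 - q * q ^ n) * q_pochhammer q q (Suc (n + k))"
      using Suc.IH IH[of "Suc n"] by (simp only: add_Suc add_Suc_right)
    also have "\<dots> = q_pochhammer q q (Suc (n + k)) * (1 - q * q ^ Suc (n + k))"
      by (simp add: algebra_simps power_add)
    finally show ?case
      by (simp add: q_pochhammer_Suc)
  qed simp
qed simp

text \<open>
  The homogeneous form, with \<open>b\<close> in place of \<open>1\<close>, is what later replaces the negative powers of
  \<open>q\<close> in Jacobi's triple product. Splitting off the factor \<open>i = 0\<close> leaves the product for \<open>aq\<close>,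
  so that the two terms of the recursion for the Gaussian binomials match the two terms of \<open>b - a\<close>.
\<close>
theorem q_binomial_theorem:
  fixes a b q :: "'a::comm_ring_1"
  shows "(\<Prod>i<n. b - a * q ^ i)
    = (\<Sum>j\<le>n. (-1) ^ j * q ^ (j choose 2) * qbinom q n j * a ^ j * b ^ (n - j))"
proof (induction n arbitrary: a)
  case (Suc n)
  let ?t = "\<lambda>j. (-1) ^ j * q ^ (j choose 2) * q ^ j * qbinom q n j * a ^ j"
  have choose_0: "(0::nat) choose 2 = 0"
    by (simp add: numeral_2_eq_2)
  have choose: "Suc j choose 2 = (j choose 2) + j" for j
    by (simp add: numeral_2_eq_2)
  have "(\<Prod>i<Suc n. b - a * q ^ i) = (b - a) * (\<Prod>i<n. b - (a * q) * q ^ i)"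
    by (subst prod.lessThan_Suc_shift) (simp add: mult_ac)
  also have "\<dots> = (b - a) * (\<Sum>j\<le>n. ?t j * b ^ (n - j))"
    by (subst Suc.IH) (simp add: power_mult_distrib mult_ac)
  also have "\<dots> = (\<Sum>j\<le>n. ?t j * b ^ (Suc n - j)) - (\<Sum>j\<le>n. a * ?t j * b ^ (n - j))"
    unfolding sum_distrib_left sum_subtractf[symmetric]
    by (intro sum.cong refl) (simp add: Suc_diff_le algebra_simps)
  also have "(\<Sum>j\<le>n. ?t j * b ^ (Suc n - j)) = (\<Sum>j\<le>Suc n. ?t j * b ^ (Suc n - j))"
    by (simp add: qbinom_eq_0)
  also have "\<dots> = b ^ Suc n + (\<Sum>j\<le>n. ?t (Suc j) * b ^ (n - j))"
    by (subst sum.atMost_Suc_shift) (simp add: choose_0)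
  also have "\<dots> - (\<Sum>j\<le>n. a * ?t j * b ^ (n - j))
      = b ^ Suc n + (\<Sum>j\<le>n. (?t (Suc j) - a * ?t j) * b ^ (n - j))"
    by (simp add: left_diff_distrib sum_subtractf)
  also have "(\<Sum>j\<le>n. (?t (Suc j) - a * ?t j) * b ^ (n - j))
      = (\<Sum>j\<le>n. (-1) ^ Suc j * q ^ (Suc j choose 2) * qbinom q (Suc n) (Suc j) * a ^ Suc j
                   * b ^ (Suc n - Suc j))"
    by (intro sum.cong refl) (simp only: choose, simp add: power_add algebra_simps)
  also have "b ^ Suc n + \<dots>
      = (\<Sum>j\<le>Suc n. (-1) ^ j * q ^ (j choose 2) * qbinom q (Suc n) j * a ^ j * b ^ (Suc n - j))"
    by (subst sum.atMost_Suc_shift) (simp add: choose_0)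
  finally show ?case .
qed (simp add: numeral_2_eq_2)

lemma qbinom_symmetric:
  fixes q :: "'a::idom"
  assumes "\<And>n. q_pochhammer q q n \<noteq> 0"
  shows "qbinom q (n + k) n = qbinom q (n + k) k"
proof -
  let ?p = "q_pochhammer q q"
  have "qbinom q (n + k) n * (?p n * ?p k) = qbinom q (n + k) k * (?p n * ?p k)"
    using qbinom_q_pochhammer[of q n k] qbinom_q_pochhammer[of q k n]
    by (simp add: add.commute mult_ac)
  then show ?thesis
    using assms by simp
qed

text \<open>
  This is the finite Jacobi triple product at \<open>x = 1\<close>. In the \<open>q\<close>-binomial theorem with base
  \<open>q\<^sup>2\<close>, \<open>2m\<close> factors, \<open>a = q\<close> and \<open>b = q^(2m)\<close>, the lower and the upper half of the factors
  \<open>q^(2m) - q^(2i+1)\<close> both give \<open>(q;q\<^sup>2)\<^sub>m\<close>, up to a sign and a power of \<open>q\<close>; on the other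
  side, completing the square gives the exponent \<open>(j - m)\<^sup>2 + 3m\<^sup>2\<close>. The common factor
  \<open>(-1)\<^sup>m q^(3m\<^sup>2)\<close> cancels.
\<close>
lemma finite_theta_expansion:
  fixes q :: "'a::idom"
  assumes q: "q \<noteq> 0" and nz: "\<And>n. q_pochhammer (q\<^sup>2) (q\<^sup>2) n \<noteq> 0"
  shows "q_pochhammer q (q\<^sup>2) m ^ 2
    = (\<Sum>k=-int m..int m. (-1) ^ nat \<bar>k\<bar> * q ^ (nat \<bar>k\<bar>)\<^sup>2 * qbinom (q\<^sup>2) (2 * m) (m + nat \<bar>k\<bar>))"
    (is "_ = ?S")
proof -
  have split: "(\<Prod>i<m+n. f i) = (\<Prod>i<m. f i) * (\<Prod>i<n. f (m + i))" for f :: "nat \<Rightarrow> 'a" and n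
    by (induction n) (simp_all add: mult_ac)
  let ?f = "\<lambda>i. q ^ (2 * m) - q * (q\<^sup>2) ^ i"
  have low: "(\<Prod>i<m. ?f i) = (-1) ^ m * q ^ m\<^sup>2 * q_pochhammer q (q\<^sup>2) m"
  proof -
    have "?f i = (- (q * (q\<^sup>2) ^ i)) * (1 - q * (q\<^sup>2) ^ (m - Suc i))" if "i < m" for i
    proof -
      have "2 * m = Suc (2 * i) + Suc (2 * (m - Suc i))"
        using that by simp
      then have "q ^ (2 * m) = q ^ Suc (2 * i) * q ^ Suc (2 * (m - Suc i))"
        by (simp only: power_add)
      then show ?thesis
        unfolding power_mult[symmetric] by (simp add: right_diff_distrib mult_ac)
    qed
    then have "(\<Prod>i<m. ?f i) = (\<Prod>i<m. - (q * (q\<^sup>2) ^ i)) * (\<Prod>i<m. 1 - q * (q\<^sup>2) ^ (m - Suc i))"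
      by (subst prod.distrib[symmetric]) (intro prod.cong, auto)
    also have "(\<Prod>i<m. - (q * (q\<^sup>2) ^ i)) = (-1) ^ m * q ^ m\<^sup>2"
      by (induction m) (simp_all add: power2_eq_square power_add power_mult_distrib mult_ac)
    also have "(\<Prod>i<m. 1 - q * (q\<^sup>2) ^ (m - Suc i)) = q_pochhammer q (q\<^sup>2) m"
      unfolding q_pochhammer_def by (rule prod.nat_diff_reindex)
    finally show ?thesis .
  qed
  have high: "(\<Prod>i<m. ?f (m + i)) = q ^ (2 * m\<^sup>2) * q_pochhammer q (q\<^sup>2) m"
  proof -
    have "?f (m + i) = q ^ (2 * m) * (1 - q * (q\<^sup>2) ^ i)" for i
      unfolding power_add power_mult right_diff_distrib
      by (simp only: mult_ac mult_1_left mult_1_right)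
    then have "(\<Prod>i<m. ?f (m + i)) = (q ^ (2 * m)) ^ m * q_pochhammer q (q\<^sup>2) m"
      by (simp add: prod.distrib q_pochhammer_def)
    also have "(q ^ (2 * m)) ^ m = q ^ (2 * m\<^sup>2)"
      by (simp only: power_mult[symmetric] power2_eq_square mult.assoc)
    finally show ?thesis .
  qed
  have "(\<Prod>i<2*m. ?f i) = (\<Prod>i<m. ?f i) * (\<Prod>i<m. ?f (m + i))"
    using split[of ?f m] by (simp only: mult_2)
  also have "\<dots> = (-1) ^ m * q ^ (3 * m\<^sup>2) * q_pochhammer q (q\<^sup>2) m ^ 2"
  proof -
    have e: "q ^ (3 * m\<^sup>2) = q ^ m\<^sup>2 * q ^ (2 * m\<^sup>2)"
      by (simp flip: power_add)
    show ?thesis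
      unfolding low high e power2_eq_square[of "q_pochhammer q (q\<^sup>2) m"] by (simp only: mult_ac)
  qed
  finally have "(\<Prod>i<2*m. ?f i) = (-1) ^ m * q ^ (3 * m\<^sup>2) * q_pochhammer q (q\<^sup>2) m ^ 2" .
  moreover have "(\<Prod>i<2*m. ?f i) = (-1) ^ m * q ^ (3 * m\<^sup>2) * ?S"
  proof -
    let ?g = "\<lambda>k. (-1) ^ nat \<bar>k\<bar> * q ^ (nat \<bar>k\<bar>)\<^sup>2 * qbinom (q\<^sup>2) (2 * m) (m + nat \<bar>k\<bar>)"
    have "(-1) ^ j * (q\<^sup>2) ^ (j choose 2) * qbinom (q\<^sup>2) (2 * m) j * q ^ j * (q ^ (2 * m)) ^ (2 * m - j)
        = (-1) ^ m * q ^ (3 * m\<^sup>2) * ?g (int j - int m)" if "j \<le> 2 * m" for j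
    proof -
      define l where "l = nat \<bar>int j - int m\<bar>"
      have l: "int l = \<bar>int j - int m\<bar>"
        by (simp add: l_def)
      have c: "2 * (j choose 2) + j = j\<^sup>2"
        by (induction j) (simp_all add: numeral_2_eq_2)
      have "int (2 * m - j) = 2 * int m - int j" "(int l)\<^sup>2 = (int j - int m)\<^sup>2"
        using that by (simp_all add: l)
      then have "int (j\<^sup>2 + 2 * m * (2 * m - j)) = int (3 * m\<^sup>2 + l\<^sup>2)"
        unfolding of_nat_add of_nat_mult of_nat_power by (simp add: power2_eq_square algebra_simps)
      then have "j\<^sup>2 + 2 * m * (2 * m - j) = 3 * m\<^sup>2 + l\<^sup>2"
        by (simp only: of_nat_eq_iff)
      then have e: "2 * (j choose 2) + j + 2 * m * (2 * m - j) = 3 * m\<^sup>2 + l\<^sup>2"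
        using c by linarith
      have s: "(-1 :: 'a) ^ j = (-1) ^ m * (-1) ^ l"
        and b: "qbinom (q\<^sup>2) (2 * m) j = qbinom (q\<^sup>2) (2 * m) (m + l)"
      proof (atomize (full), cases "j \<ge> m")
        case True
        then have "j = m + l"
          using l by linarith
        then show "(-1 :: 'a) ^ j = (-1) ^ m * (-1) ^ l
            \<and> qbinom (q\<^sup>2) (2 * m) j = qbinom (q\<^sup>2) (2 * m) (m + l)"
          by (simp add: power_add)
      next
        case False
        then have m: "m = j + l" and "2 * m = j + (m + l)"
          using l by linarith+
        then have "qbinom (q\<^sup>2) (2 * m) j = qbinom (q\<^sup>2) (2 * m) (m + l)"
          using qbinom_symmetric[OF nz, of j "m + l"] by (simp only:)
        moreover have "(-1 :: 'a) ^ j = (-1) ^ m * (-1) ^ l"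
          by (simp add: m power_add mult.assoc flip: power_mult_distrib)
        ultimately show "(-1 :: 'a) ^ j = (-1) ^ m * (-1) ^ l
            \<and> qbinom (q\<^sup>2) (2 * m) j = qbinom (q\<^sup>2) (2 * m) (m + l)"
          by blast
      qed
      have "(q\<^sup>2) ^ (j choose 2) * q ^ j * (q ^ (2 * m)) ^ (2 * m - j) = q ^ (3 * m\<^sup>2) * q ^ l\<^sup>2"
        using arg_cong[OF e, of "\<lambda>x. q ^ x"] by (simp only: power_add power_mult)
      then show ?thesis
        unfolding s b l_def[symmetric] by (simp add: mult_ac)
    qed
    then have "(\<Prod>i<2*m. ?f i) = (\<Sum>j\<le>2*m. (-1) ^ m * q ^ (3 * m\<^sup>2) * ?g (int j - int m))"
      unfolding q_binomial_theorem by (intro sum.cong) simp_all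
    also have "\<dots> = (-1) ^ m * q ^ (3 * m\<^sup>2) * (\<Sum>j\<le>2*m. ?g (int j - int m))"
      by (simp only: sum_distrib_left)
    also have "(\<Sum>j\<le>2*m. ?g (int j - int m)) = ?S"
      by (rule sum.reindex_bij_witness[of _ "\<lambda>k. nat (k + int m)" "\<lambda>j. int j - int m"])
        (simp_all add: nat_le_iff)
    finally show ?thesis .
  qed
  ultimately have "(-1) ^ m * q ^ (3 * m\<^sup>2) * q_pochhammer q (q\<^sup>2) m ^ 2
      = (-1) ^ m * q ^ (3 * m\<^sup>2) * ?S"
    by (simp only:)
  moreover have "(-1) ^ m * q ^ (3 * m\<^sup>2) \<noteq> 0"
    using q by simp
  ultimately show ?thesis
    by (rule mult_left_cancel[THEN iffD1, rotated])
qed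

section \<open>Limits of formal power series\<close>

lemma convergent_fpsI:
  fixes f :: "nat \<Rightarrow> 'a::comm_ring_1 fps"
  assumes "\<And>n k. n < k \<Longrightarrow> fps_nth (f (Suc k)) n = fps_nth (f k) n"
  shows "convergent f"
proof (rule convergentI, rule tendsto_fpsI)
  fix n
  have "fps_nth (f k) n = fps_nth (f (Suc n)) n" if "k \<ge> Suc n" for k
    using that by (induction k rule: dec_induct) (simp_all add: assms)
  then show "\<forall>\<^sub>F k in sequentially. fps_nth (f k) n = fps_nth (Abs_fps (\<lambda>n. fps_nth (f (Suc n)) n)) n"
    unfolding fps_nth_Abs_fps by (rule eventually_mono[OF eventually_ge_at_top[of "Suc n"]])
qed

lemma tendsto_add_fps:
  fixes f g :: "'b \<Rightarrow> 'a::comm_ring_1 fps"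
  assumes "(f \<longlongrightarrow> a) F" and "(g \<longlongrightarrow> b) F"
  shows "((\<lambda>x. f x + g x) \<longlongrightarrow> a + b) F"
proof (rule tendsto_fpsI)
  fix n
  have "\<forall>\<^sub>F x in F. fps_nth (f x) n = fps_nth a n" "\<forall>\<^sub>F x in F. fps_nth (g x) n = fps_nth b n"
    using assms by (auto simp: tendsto_fps_iff)
  then show "\<forall>\<^sub>F x in F. fps_nth (f x + g x) n = fps_nth (a + b) n"
    by eventually_elim simp
qed

lemma tendsto_mult_fps:
  fixes f g :: "'b \<Rightarrow> 'a::comm_ring_1 fps"
  assumes "(f \<longlongrightarrow> a) F" and "(g \<longlongrightarrow> b) F"
  shows "((\<lambda>x. f x * g x) \<longlongrightarrow> a * b) F"
proof (rule tendsto_fpsI)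
  fix n
  have "\<forall>\<^sub>F x in F. \<forall>i\<in>{..n}. fps_nth (f x) i = fps_nth a i"
       "\<forall>\<^sub>F x in F. \<forall>i\<in>{..n}. fps_nth (g x) i = fps_nth b i"
    using assms by (auto simp: tendsto_fps_iff intro!: eventually_ball_finite)
  then show "\<forall>\<^sub>F x in F. fps_nth (f x * g x) n = fps_nth (a * b) n"
    by eventually_elim (auto simp: fps_mult_nth intro!: sum.cong)
qed

section \<open>The telescoping sum\<close>

lemma q_pochhammer_nth_0:
  "fps_nth a 0 = 0 \<Longrightarrow> fps_nth (q_pochhammer a q n) 0 = 1"
  by (induction n) (simp_all add: q_pochhammer_Suc)

lemma inverse_q_pochhammer_Suc:
  fixes a q :: "'a::field fps"
  assumes "fps_nth a 0 = 0"
  shows "inverse (q_pochhammer a q n) = (1 - a * q ^ n) * inverse (q_pochhammer a q (Suc n))"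
proof -
  have "inverse (1 - a * q ^ n) * (1 - a * q ^ n) = 1"
    by (rule inverse_mult_eq_1) (simp add: assms)
  then show ?thesis
    by (simp add: q_pochhammer_Suc fps_inverse_mult mult_ac)
qed

lemma qbinom_inverse:
  fixes q :: "'a::field fps"
  assumes "fps_nth q 0 = 0"
  shows "qbinom q (n + k) k
    = q_pochhammer q q (n + k) * inverse (q_pochhammer q q n) * inverse (q_pochhammer q q k)"
proof -
  have inv: "q_pochhammer q q m * inverse (q_pochhammer q q m) = 1" for m
    using q_pochhammer_nth_0[OF assms, of q m] by (simp add: inverse_mult_eq_1')
  have "qbinom q (n + k) k = qbinom q (n + k) k
      * (q_pochhammer q q n * inverse (q_pochhammer q q n))
      * (q_pochhammer q q k * inverse (q_pochhammer q q k))"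
    by (simp add: inv)
  then show ?thesis
    unfolding qbinom_q_pochhammer[of q n k, symmetric] by (simp only: mult_ac)
qed

text \<open>
  In the language of Bailey pairs relative to \<open>a = 1\<close>, this is the \<open>M\<close>-th partial sum of the
  series \<open>\<gamma>\<^sub>k = \<Sum>\<^sub>m \<delta>\<^sub>m / ((q)\<^bsub>m-k\<^esub> (q)\<^bsub>m+k\<^esub>)\<close> conjugate to
  \<open>\<delta>\<^sub>m = (q)\<^bsub>2m\<^esub> q\<^sup>m / (-q;q)\<^sub>m\<close>. Terms with \<open>m < k\<close> vanish.
\<close>
definition gamma_partial :: "'a::field fps \<Rightarrow> nat \<Rightarrow> nat \<Rightarrow> 'a fps" where
  "gamma_partial q M k
    = (\<Sum>m<M. qbinom q (2 * m) (m + k) * q ^ m * inverse (q_pochhammer (- q) q m))"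

text \<open>
  What the step from \<open>M\<close> to \<open>M + 1\<close> of the telescoping sum below amounts to for \<open>M > k\<close>, once the
  common factor of its Gaussian binomials is removed. Here \<open>y = q\<^sup>k\<close> and \<open>z = q^(M-k-1)\<close>, so
  that \<open>y * (q * z) = q\<^sup>M\<close>.
\<close>
lemma telescoping_identity:
  fixes q y z :: "'a::comm_ring_1"
  shows "y * (q * z) * (1 + q * (y * (q * z)))
      * ((1 - q * (y * y * (q * z))) * (1 - q * (q * (y * y * (q * z))))
         + q ^ 3 * y ^ 3 * ((1 - q * z) * (1 - z)))
    = y * (1 + q * y) * ((1 - q * (y * (q * z))\<^sup>2) * (1 - q\<^sup>2 * (y * (q * z))\<^sup>2)
        - (1 - q * z) * (1 - q * (q * (y * y * (q * z)))) * (1 + q * (y * (q * z))))"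
  by (simp add: power2_eq_square power3_eq_cube ring_distribs mult_ac add_ac)

text \<open>
  The right-hand side is a \<open>q\<close>-Zeilberger certificate for the left-hand side: its increment from
  \<open>M\<close> to \<open>M + 1\<close> is the sum of the \<open>M\<close>-th terms on the left. The factor that depends on \<open>M\<close> tends to
  the reciprocal of \<open>(q\<^sup>2;q\<^sup>2)\<^sub>\<infinity>\<close>, which makes the recurrence of the limits so simple.
\<close>
lemma gamma_partial_recurrence:
  fixes q :: "'a::field fps"
  assumes q: "fps_nth q 0 = 0"
  shows "gamma_partial q M k + q ^ (3 * k + 3) * gamma_partial q M (k + 2)
    = q ^ k * (1 + q ^ Suc k) * (qbinom q (2 * M) (M + k + 1) * inverse (q_pochhammer (- q) q M))"
proof (induction M)
  case 0
  show ?case by (simp add: gamma_partial_def)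
next
  case (Suc M)
  let ?p = "q_pochhammer q q" and ?v = "\<lambda>m. inverse (q_pochhammer (- q) q m)"
  let ?u = "\<lambda>m. inverse (q_pochhammer q q m)"
  let ?B = "\<lambda>m k. qbinom q (2 * m) (m + k)"
  have v: "?v M = (1 + q ^ Suc M) * ?v (Suc M)"
    using inverse_q_pochhammer_Suc[of "- q" q M] q by simp
  have u: "?u m = (1 - q ^ Suc m) * ?u (Suc m)" for m
    using inverse_q_pochhammer_Suc[of q q m] q by simp
  have step: "q ^ M * ?v M * (?B M k + q ^ (3 * k + 3) * ?B M (k + 2))
      = q ^ k * (1 + q ^ Suc k) * (?B (Suc M) (k + 1) * ?v (Suc M) - ?B M (k + 1) * ?v M)"
  proof (cases "M < k")
    case True
    then show ?thesis by (simp add: qbinom_eq_0)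
  next
    case False
    then obtain i where M: "M = k + i"
      by (metis le_Suc_ex not_less)
    \<comment> \<open>The indices of \<open>?u\<close> are the largest lower entries that occur, so that each of the Gaussian
      binomials, multiplied by \<open>?v (Suc M)\<close>, is a polynomial multiple of \<open>W\<close>.\<close>
    define W where "W = ?p (2 * M) * ?u i * ?u (M + k + 2) * ?v (Suc M)"
    have B: "?B M l = ?p (2 * M) * ?u (M - l) * ?u (M + l)" if "l \<le> M" for l
      using qbinom_inverse[OF q, of "M - l" "M + l"] that by (simp add: mult_2)
    have "i + (M + k + 2) = 2 * Suc M" "Suc M + (k + 1) = M + k + 2"
      by (simp_all add: M)
    then have "?B (Suc M) (k + 1) = ?p (2 * Suc M) * ?u i * ?u (M + k + 2)"
      using qbinom_inverse[OF q, of i "M + k + 2"] by (simp only:)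
    then have B0: "?B (Suc M) (k + 1) * ?v (Suc M) = (1 - q ^ (2 * M + 1)) * (1 - q ^ (2 * M + 2)) * W"
      by (simp add: W_def q_pochhammer_Suc mult_ac)
    have u1: "?u (M + k + 1) = (1 - q ^ (M + k + 2)) * ?u (M + k + 2)"
      using u[of "M + k + 1"] by simp
    have u0: "?u (M + k) = (1 - q ^ (M + k + 1)) * ?u (M + k + 1)"
      using u[of "M + k"] by simp
    have "?B M k = ?p (2 * M) * ?u i * ?u (M + k)"
      using B[of k] by (simp add: M)
    then have B1: "?B M k * ?v (Suc M) = (1 - q ^ (M + k + 1)) * (1 - q ^ (M + k + 2)) * W"
      by (simp only: u0 u1 W_def mult_ac)
    show ?thesis
    proof (cases i)
      case 0
      then have "?B M (k + 1) = 0" "?B M (k + 2) = 0"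
        by (simp_all add: M qbinom_eq_0)
      then have "q ^ M * ?v M * (?B M k + q ^ (3 * k + 3) * ?B M (k + 2))
          = q ^ M * (1 + q ^ Suc M) * (?B M k * ?v (Suc M))"
        by (simp only: v mult_ac mult_zero_left mult_zero_right add_0_right)
      also have "\<dots> = q ^ k * (1 + q ^ Suc k) * (?B (Suc M) (k + 1) * ?v (Suc M))"
      proof -
        have "k = M" "M + k + 1 = 2 * M + 1" "M + k + 2 = 2 * M + 2"
          by (simp_all add: M 0)
        then show ?thesis
          unfolding B0 B1 by (simp only:)
      qed
      finally show ?thesis
        using \<open>?B M (k + 1) = 0\<close> by (simp only: mult_zero_left diff_0_right)
    next
      case (Suc j)
      have "?B M (k + 1) = ?p (2 * M) * ?u j * ?u (M + k + 1)"
        using B[of "k + 1"] by (simp add: M Suc)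
      then have B2: "?B M (k + 1) * ?v (Suc M) = (1 - q ^ Suc j) * (1 - q ^ (M + k + 2)) * W"
        by (simp only: u[of j] u1 W_def Suc mult_ac)
      have B3: "?B M (k + 2) * ?v (Suc M) = (1 - q ^ Suc j) * (1 - q ^ j) * W"
      proof (cases j)
        case 0
        then show ?thesis by (simp add: M Suc qbinom_eq_0)
      next
        case (Suc j')
        then have "?B M (k + 2) = ?p (2 * M) * ?u j' * ?u (M + k + 2)"
          using B[of "k + 2"] by (simp add: M \<open>i = Suc j\<close>)
        moreover have "?u j' = (1 - q ^ j) * ((1 - q ^ Suc j) * ?u i)"
          using u[of j'] u[of j] by (simp only: Suc \<open>i = Suc j\<close>)
        ultimately show ?thesis
          by (simp only: W_def mult_ac)
      qed
      have sq: "q ^ (2 * M) = (q ^ M)\<^sup>2"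
        by (simp add: mult.commute flip: power_mult)
      have pM: "q ^ M = q ^ k * (q * q ^ j)"
        by (simp add: M Suc power_add)
      have pw: "q ^ M = q ^ k * (q * q ^ j)" "q ^ Suc M = q * (q ^ k * (q * q ^ j))"
        "q ^ (M + k + 1) = q * (q ^ k * q ^ k * (q * q ^ j))"
        "q ^ (M + k + 2) = q * (q * (q ^ k * q ^ k * (q * q ^ j)))"
        "q ^ (2 * M + 1) = q * (q ^ k * (q * q ^ j))\<^sup>2"
        "q ^ (2 * M + 2) = q\<^sup>2 * (q ^ k * (q * q ^ j))\<^sup>2"
        "q ^ (3 * k + 3) = q ^ 3 * (q ^ k) ^ 3" "q ^ Suc j = q * q ^ j" "q ^ Suc k = q * q ^ k"
        by (simp_all add: power_add power_mult power2_eq_square power3_eq_cube sq pM mult_ac)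
      have "q ^ M * ?v M * (?B M k + q ^ (3 * k + 3) * ?B M (k + 2))
          = q ^ M * (1 + q ^ Suc M) * (?B M k * ?v (Suc M) + q ^ (3 * k + 3) * (?B M (k + 2) * ?v (Suc M)))"
        by (simp add: v algebra_simps)
      also have "\<dots> = q ^ k * (1 + q ^ Suc k)
          * (?B (Suc M) (k + 1) * ?v (Suc M) - (1 + q ^ Suc M) * (?B M (k + 1) * ?v (Suc M)))"
      proof -
        have W1: "a * b * (c * d * W + e * (f * g * W)) = a * b * (c * d + e * (f * g)) * W"
          for a b c d e f g by (simp add: algebra_simps)
        have W2: "a * b * (c * d * W - e * (f * g * W)) = a * b * (c * d - f * g * e) * W"
          for a b c d e f g by (simp add: algebra_simps)
        show ?thesis
          unfolding B0 B1 B2 B3 W1 W2 unfolding pw telescoping_identity ..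
      qed
      finally show ?thesis
        by (simp add: v mult_ac)
    qed
  qed
  have "gamma_partial q (Suc M) k + q ^ (3 * k + 3) * gamma_partial q (Suc M) (k + 2)
      = (gamma_partial q M k + q ^ (3 * k + 3) * gamma_partial q M (k + 2))
        + q ^ M * ?v M * (?B M k + q ^ (3 * k + 3) * ?B M (k + 2))"
    by (simp add: gamma_partial_def algebra_simps)
  then show ?case
    unfolding Suc.IH step by (simp add: algebra_simps)
qed

section \<open>The rows of the double sum\<close>

lemma convergent_q_pochhammer:
  fixes a :: "'a::comm_ring_1 fps"
  assumes "p > 0"
  shows "convergent (\<lambda>n. q_pochhammer a (fps_X ^ p) n)"
proof (rule convergent_fpsI)
  fix n k :: nat
  assume "n < k"
  then have "n < p * k"
    using assms by (metis less_le_trans mult_le_mono1 mult_1 Suc_leI One_nat_def)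
  moreover have "q_pochhammer a (fps_X ^ p) (Suc k)
      = q_pochhammer a (fps_X ^ p) k - fps_X ^ (p * k) * (a * q_pochhammer a (fps_X ^ p) k)"
    unfolding q_pochhammer_Suc power_mult right_diff_distrib
    by (simp only: mult_1_left mult_1_right mult_ac)
  ultimately show "fps_nth (q_pochhammer a (fps_X ^ p) (Suc k)) n
      = fps_nth (q_pochhammer a (fps_X ^ p) k) n"
    by (simp only: fps_sub_nth fps_X_power_mult_nth if_True diff_0_right)
qed

lemma convergent_gamma_partial: "convergent (\<lambda>M. gamma_partial (fps_X\<^sup>2 :: 'a::field fps) M k)"
proof (rule convergent_fpsI)
  fix n M :: nat
  assume "n < M"
  let ?q = "fps_X\<^sup>2 :: 'a fps"
  have "gamma_partial ?q (Suc M) k = gamma_partial ?q M k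
      + fps_X ^ (2 * M) * (qbinom ?q (2 * M) (M + k) * inverse (q_pochhammer (- ?q) ?q M))"
    unfolding gamma_partial_def sum.lessThan_Suc power_mult by (simp only: mult_ac)
  moreover have "n < 2 * M"
    using \<open>n < M\<close> by simp
  ultimately show "fps_nth (gamma_partial ?q (Suc M) k) n = fps_nth (gamma_partial ?q M k) n"
    by (simp only: fps_add_nth fps_X_power_mult_nth if_True add_0_right)
qed

definition gamma_row :: "nat \<Rightarrow> complex fps" where
  "gamma_row k = q_pochhammer_inf (fps_X ^ 4) (fps_X ^ 4) * lim (\<lambda>M. gamma_partial (fps_X\<^sup>2) M k)"

lemma gamma_row_tendsto:
  "(\<lambda>M. q_pochhammer_inf (fps_X ^ 4) (fps_X ^ 4) * gamma_partial (fps_X\<^sup>2) M k) \<longlonglongrightarrow> gamma_row k"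
  unfolding gamma_row_def
  by (intro tendsto_mult_fps tendsto_const convergent_gamma_partial[THEN convergent_LIMSEQ_iff[THEN iffD1]])

text \<open>
  Let \<open>L\<close> and \<open>N\<close> be the limits of \<open>(q;q)\<^sub>n\<close> and \<open>(-q;q)\<^sub>n\<close>. Then \<open>[2M, M+k]\<^sub>q\<close> tends to
  \<open>L / (L * L)\<close>, and the infinite product equals \<open>L * N\<close>.
\<close>
lemma central_qbinom_limit:
  fixes k :: nat
  defines "q \<equiv> fps_X\<^sup>2 :: complex fps"
  shows "(\<lambda>M. q_pochhammer_inf (fps_X ^ 4) (fps_X ^ 4)
      * (qbinom q (2 * M) (M + k) * inverse (q_pochhammer (- q) q M))) \<longlonglongrightarrow> 1"
proof -
  have q0: "fps_nth q 0 = 0" "fps_nth (- q) 0 = 0"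
    by (simp_all add: q_def)
  obtain L where L: "(\<lambda>n. q_pochhammer q q n) \<longlonglongrightarrow> L"
    using convergent_q_pochhammer[of 2 q] by (auto simp: q_def convergent_def)
  obtain N where N: "(\<lambda>n. q_pochhammer (- q) q n) \<longlonglongrightarrow> N"
    using convergent_q_pochhammer[of 2 "- q"] by (auto simp: q_def convergent_def)
  have nth_0: "fps_nth K 0 = 1"
    if "(\<lambda>n. q_pochhammer a q n) \<longlonglongrightarrow> K" and "fps_nth a 0 = 0" for a K :: "complex fps"
  proof -
    have "\<forall>\<^sub>F n in sequentially. fps_nth (q_pochhammer a q n) 0 = fps_nth K 0"
      using that(1) by (simp only: tendsto_fps_iff)
    then show ?thesis
      using q_pochhammer_nth_0[OF that(2)] by simp
  qed
  have L0: "fps_nth L 0 = 1" and N0: "fps_nth N 0 = 1"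
    using nth_0[OF L] nth_0[OF N] q0 by auto
  have E: "q_pochhammer_inf (fps_X ^ 4) (fps_X ^ 4) = L * N"
  proof (rule LIMSEQ_unique)
    have "q_pochhammer q q n * q_pochhammer (- q) q n = (\<Prod>j<n. 1 - fps_X ^ 4 * (fps_X ^ 4) ^ j)" for n
    proof -
      have "(1 - q * q ^ j) * (1 - (- q) * q ^ j) = 1 - fps_X ^ 4 * (fps_X ^ 4) ^ j" for j
      proof -
        have q2: "fps_X ^ 4 = q * q"
          unfolding q_def by (simp only: power_add[symmetric]) simp
        show ?thesis
          unfolding q2 power_mult_distrib by (simp add: algebra_simps)
      qed
      then show ?thesis
        by (simp only: q_pochhammer_def flip: prod.distrib)
    qed
    then show "(\<lambda>n. q_pochhammer q q n * q_pochhammer (- q) q n)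
        \<longlonglongrightarrow> q_pochhammer_inf (fps_X ^ 4) (fps_X ^ 4)"
      using has_prod_imp_tendsto'[OF has_prod_q_pochhammer_inf] by (simp only:)
  qed (intro tendsto_mult_fps L N)
  have shift: "filterlim (\<lambda>M. M - k) sequentially sequentially"
    "filterlim (\<lambda>M. M + k) sequentially sequentially"
    "filterlim (\<lambda>M. 2 * M) sequentially sequentially"
    by (rule filterlim_minus_const_nat_at_top, rule filterlim_add_const_nat_at_top)
      (rule filterlim_subseq, simp add: strict_mono_def)
  have inv: "(\<lambda>n. inverse (q_pochhammer q q n)) \<longlonglongrightarrow> inverse L"
    "(\<lambda>n. inverse (q_pochhammer (- q) q n)) \<longlonglongrightarrow> inverse N"
    by (intro tendsto_inverse_fps L N; simp add: L0 N0)+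
  have "(\<lambda>M. q_pochhammer_inf (fps_X ^ 4) (fps_X ^ 4)
      * (q_pochhammer q q (2 * M) * inverse (q_pochhammer q q (M - k))
        * inverse (q_pochhammer q q (M + k)) * inverse (q_pochhammer (- q) q M)))
      \<longlonglongrightarrow> L * N * (L * inverse L * inverse L * inverse N)"
    unfolding E
    by (intro tendsto_mult_fps tendsto_const inv filterlim_compose[OF L] filterlim_compose[OF inv(1)] shift)
  also have "L * N * (L * inverse L * inverse L * inverse N)
      = (L * inverse L) * (L * inverse L) * (N * inverse N)"
    by (simp only: mult_ac)
  also have "\<dots> = 1"
    using L0 N0 by (simp add: inverse_mult_eq_1')
  finally show ?thesis
  proof (rule Lim_transform_eventually)
    have "qbinom q (2 * M) (M + k) = q_pochhammer q q (2 * M) * inverse (q_pochhammer q q (M - k))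
        * inverse (q_pochhammer q q (M + k))" if "k \<le> M" for M
    proof -
      have "M - k + (M + k) = 2 * M"
        using that by simp
      then show ?thesis
        using qbinom_inverse[OF q0(1), of "M - k" "M + k"] by (simp only:)
    qed
    then show "\<forall>\<^sub>F M in sequentially. q_pochhammer_inf (fps_X ^ 4) (fps_X ^ 4)
      * (q_pochhammer q q (2 * M) * inverse (q_pochhammer q q (M - k))
        * inverse (q_pochhammer q q (M + k)) * inverse (q_pochhammer (- q) q M))
      = q_pochhammer_inf (fps_X ^ 4) (fps_X ^ 4)
      * (qbinom q (2 * M) (M + k) * inverse (q_pochhammer (- q) q M))"
      by (intro eventually_mono[OF eventually_ge_at_top[of k]]) (simp only:)
  qed
qed

lemma gamma_row_recurrence:
  "gamma_row k + (fps_X\<^sup>2) ^ (3 * k + 3) * gamma_row (k + 2) = (fps_X\<^sup>2) ^ k * (1 + (fps_X\<^sup>2) ^ Suc k)"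
proof (rule LIMSEQ_unique)
  let ?q = "fps_X\<^sup>2 :: complex fps" and ?E = "q_pochhammer_inf (fps_X ^ 4) (fps_X ^ 4) :: complex fps"
  show "(\<lambda>M. ?E * gamma_partial ?q M k + ?q ^ (3 * k + 3) * (?E * gamma_partial ?q M (k + 2)))
      \<longlonglongrightarrow> gamma_row k + ?q ^ (3 * k + 3) * gamma_row (k + 2)"
    by (intro tendsto_add_fps tendsto_mult_fps[OF tendsto_const] gamma_row_tendsto)
  have "?E * gamma_partial ?q M k + ?q ^ (3 * k + 3) * (?E * gamma_partial ?q M (k + 2))
      = ?q ^ k * (1 + ?q ^ Suc k)
        * (?E * (qbinom ?q (2 * M) (M + Suc k) * inverse (q_pochhammer (- ?q) ?q M)))" for M
  proof -
    have "?E * gamma_partial ?q M k + ?q ^ (3 * k + 3) * (?E * gamma_partial ?q M (k + 2))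
        = ?E * (gamma_partial ?q M k + ?q ^ (3 * k + 3) * gamma_partial ?q M (k + 2))"
      by (simp only: distrib_left mult_ac)
    also have "\<dots> = ?E * (?q ^ k * (1 + ?q ^ Suc k)
        * (qbinom ?q (2 * M) (M + Suc k) * inverse (q_pochhammer (- ?q) ?q M)))"
      by (subst gamma_partial_recurrence) (simp_all only: Suc_eq_plus1 add.assoc, simp)
    finally show ?thesis
      by (simp only: mult_ac)
  qed
  moreover have "(\<lambda>M. ?q ^ k * (1 + ?q ^ Suc k)
      * (?E * (qbinom ?q (2 * M) (M + Suc k) * inverse (q_pochhammer (- ?q) ?q M))))
      \<longlonglongrightarrow> ?q ^ k * (1 + ?q ^ Suc k) * 1"
    by (intro tendsto_mult_fps[OF tendsto_const] central_qbinom_limit)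
  ultimately show "(\<lambda>M. ?E * gamma_partial ?q M k + ?q ^ (3 * k + 3) * (?E * gamma_partial ?q M (k + 2)))
      \<longlonglongrightarrow> ?q ^ k * (1 + ?q ^ Suc k)"
    by (simp only: mult_1_right)
qed

text \<open>
  Up to sign, the contribution of each of the indices \<open>k\<close> and \<open>-k\<close> to the double sum.
\<close>
definition hecke_row :: "nat \<Rightarrow> complex fps" where
  "hecke_row k = fps_X ^ k\<^sup>2 * gamma_row k"

lemma hecke_row_recurrence:
  "hecke_row k = fps_X ^ (k\<^sup>2 + 2 * k) + fps_X ^ (k\<^sup>2 + 4 * k + 2) - fps_X ^ (2 * k + 2) * hecke_row (k + 2)"
proof -
  have "k\<^sup>2 + 2 * (3 * k + 3) = (2 * k + 2) + (k + 2)\<^sup>2"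
    by (simp add: power2_eq_square)
  then have e: "fps_X ^ k\<^sup>2 * (fps_X\<^sup>2) ^ (3 * k + 3) = fps_X ^ (2 * k + 2) * (fps_X ^ (k + 2)\<^sup>2 :: complex fps)"
    by (simp only: power_mult[symmetric] power_add[symmetric])
  have "gamma_row k = (fps_X\<^sup>2) ^ k * (1 + (fps_X\<^sup>2) ^ Suc k) - (fps_X\<^sup>2) ^ (3 * k + 3) * gamma_row (k + 2)"
    using gamma_row_recurrence[of k] by (simp only: eq_diff_eq)
  then have "hecke_row k = fps_X ^ k\<^sup>2 * ((fps_X\<^sup>2) ^ k * (1 + (fps_X\<^sup>2) ^ Suc k))
      - fps_X ^ k\<^sup>2 * (fps_X\<^sup>2) ^ (3 * k + 3) * gamma_row (k + 2)"
    by (simp only: hecke_row_def right_diff_distrib mult.assoc)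
  also have "fps_X ^ k\<^sup>2 * ((fps_X\<^sup>2) ^ k * (1 + (fps_X\<^sup>2) ^ Suc k))
      = (fps_X ^ (k\<^sup>2 + 2 * k) + fps_X ^ (k\<^sup>2 + 4 * k + 2) :: complex fps)"
  proof -
    have "k\<^sup>2 + 2 * k + 2 * Suc k = k\<^sup>2 + 4 * k + 2"
      by simp
    then show ?thesis
      by (simp only: distrib_left mult_1_right power_mult[symmetric] power_add[symmetric] add.assoc)
  qed
  finally show ?thesis
    by (simp only: e hecke_row_def mult.assoc)
qed

text \<open>
  Applying the recurrence twice expresses row \<open>k\<close> by four monomials and by row \<open>k + 4\<close> shifted by
  \<open>4k + 8\<close>. This shift is divisible by \<open>8\<close> for even \<open>k\<close> and by \<open>4\<close> for odd \<open>k\<close>, so it preserves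
  the condition on the exponent and lowers the exponent. The monomials do not contribute:
  for odd \<open>k\<close> their exponents are odd; for even \<open>k\<close> the number \<open>k\<^sup>2 + 2k\<close> is divisible by \<open>8\<close>, which
  makes their exponents \<open>0\<close> modulo \<open>8\<close> or \<open>2\<close> modulo \<open>4\<close>.
\<close>
lemma hecke_row_nth_eq_0:
  assumes "odd k \<and> even n \<or> even k \<and> n mod 8 = 4"
  shows "fps_nth (hecke_row k) n = 0"
  using assms
proof (induction n arbitrary: k rule: less_induct)
  case (less n)
  let ?e = "k\<^sup>2 + 2 * k"
  have step: "hecke_row k = fps_X ^ ?e + fps_X ^ (?e + 2 * k + 2) - fps_X ^ (?e + 6 * k + 10)
      - fps_X ^ (?e + 8 * k + 16) + fps_X ^ (4 * k + 8) * hecke_row (k + 4)"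
  proof -
    have "hecke_row (k + 2) = fps_X ^ (k\<^sup>2 + 6 * k + 8) + fps_X ^ (k\<^sup>2 + 8 * k + 14)
        - fps_X ^ (2 * k + 6) * hecke_row (k + 4)"
    proof -
      have "(k + 2)\<^sup>2 + 2 * (k + 2) = k\<^sup>2 + 6 * k + 8" "(k + 2)\<^sup>2 + 4 * (k + 2) + 2 = k\<^sup>2 + 8 * k + 14"
        "2 * (k + 2) + 2 = 2 * k + 6" "k + 2 + 2 = k + 4"
        by (simp_all add: power2_eq_square)
      then show ?thesis
        using hecke_row_recurrence[of "k + 2"] by (simp only:)
    qed
    then have "fps_X ^ (2 * k + 2) * hecke_row (k + 2) = fps_X ^ (2 * k + 2 + (k\<^sup>2 + 6 * k + 8))
        + fps_X ^ (2 * k + 2 + (k\<^sup>2 + 8 * k + 14)) - fps_X ^ (2 * k + 2 + (2 * k + 6)) * hecke_row (k + 4)"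
      by (simp only: right_diff_distrib distrib_left power_add mult.assoc)
    moreover have "2 * k + 2 + (k\<^sup>2 + 6 * k + 8) = ?e + 6 * k + 10"
      "2 * k + 2 + (k\<^sup>2 + 8 * k + 14) = ?e + 8 * k + 16" "2 * k + 2 + (2 * k + 6) = 4 * k + 8"
      "k\<^sup>2 + 4 * k + 2 = ?e + 2 * k + 2"
      by simp_all
    ultimately show ?thesis
      using hecke_row_recurrence[of k] by (simp only: diff_diff_eq2 diff_add_eq diff_diff_eq)
  qed
  have ne: "n \<noteq> ?e" "n \<noteq> ?e + 2 * k + 2" "n \<noteq> ?e + 6 * k + 10" "n \<noteq> ?e + 8 * k + 16"
  proof -
    have "n \<noteq> ?e \<and> n \<noteq> ?e + 2 * k + 2 \<and> n \<noteq> ?e + 6 * k + 10 \<and> n \<noteq> ?e + 8 * k + 16"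
    proof (cases "even k")
      case False
      then have "even n" "odd ?e"
        using less.prems by auto
      then show ?thesis by auto
    next
      case True
      then obtain j where k: "k = 2 * j" by blast
      have "even (j * (j + 1))"
        by simp
      then obtain i where "j * (j + 1) = 2 * i" by blast
      then have e: "?e = 8 * i"
        by (simp add: k power2_eq_square)
      have "n mod 8 = 4"
        using less.prems True by simp
      then obtain a where n: "n = 8 * a + 4"
        by (metis mult_div_mod_eq)
      show ?thesis
        unfolding e unfolding k n by (intro conjI; presburger)
    qed
    then show "n \<noteq> ?e" "n \<noteq> ?e + 2 * k + 2" "n \<noteq> ?e + 6 * k + 10" "n \<noteq> ?e + 8 * k + 16"
      by auto
  qed
  have "fps_nth (fps_X ^ (4 * k + 8) * hecke_row (k + 4)) n = 0"
  proof (cases "n < 4 * k + 8")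
    case False
    have "odd (k + 4) \<and> even (n - (4 * k + 8)) \<or> even (k + 4) \<and> (n - (4 * k + 8)) mod 8 = 4"
    proof (cases "even k")
      case True
      then obtain j where k: "k = 2 * j" by blast
      obtain a where n: "n = 8 * a + 4"
        using less.prems True by (metis mult_div_mod_eq)
      have "n - (4 * k + 8) = 4 + 8 * (a - Suc j)"
        using False unfolding k n by simp
      then have "(n - (4 * k + 8)) mod 8 = 4"
        by (simp only: mod_mult_self2) simp
      with True show ?thesis by simp
    qed (use less.prems in simp)
    moreover have "n - (4 * k + 8) < n"
      using False by simp
    ultimately have "fps_nth (hecke_row (k + 4)) (n - (4 * k + 8)) = 0"
      by (intro less.IH)
    then show ?thesis
      using False by (simp only: fps_X_power_mult_nth if_False)
  qed (simp only: fps_X_power_mult_nth if_True)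
  then show ?case
    unfolding step by (simp only: fps_add_nth fps_sub_nth fps_X_power_nth ne if_False
        add_0_right diff_0_right)
qed

section \<open>The double sum\<close>

lemma sum_S_term:
  "(\<Sum>m<M. S_term m)
    = (\<Sum>k=-int M..int M. (-1) ^ nat \<bar>k\<bar> * fps_X ^ (nat \<bar>k\<bar>)\<^sup>2 * gamma_partial (fps_X\<^sup>2) M (nat \<bar>k\<bar>))"
proof -
  let ?q = "fps_X\<^sup>2 :: complex fps"
  let ?v = "\<lambda>m. inverse (q_pochhammer (- ?q) ?q m)"
  let ?t = "\<lambda>m k. (-1) ^ nat \<bar>k\<bar> * fps_X ^ (nat \<bar>k\<bar>)\<^sup>2
    * (qbinom ?q (2 * m) (m + nat \<bar>k\<bar>) * ?q ^ m * ?v m)"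
  have "q_pochhammer ?q ?q n \<noteq> 0" for n
    using q_pochhammer_nth_0[of ?q ?q n] by (metis fps_X_power_nth fps_zero_nth zero_neq_numeral zero_neq_one)
  then have theta: "q_pochhammer fps_X ?q m ^ 2 = (\<Sum>k=-int m..int m.
      (-1) ^ nat \<bar>k\<bar> * fps_X ^ (nat \<bar>k\<bar>)\<^sup>2 * qbinom ?q (2 * m) (m + nat \<bar>k\<bar>))" for m
    by (intro finite_theta_expansion) (simp_all only: fps_X_neq_zero not_False_eq_True)
  have "S_term m = (\<Sum>k=-int M..int M. ?t m k)" if "m < M" for m
  proof -
    have "S_term m = q_pochhammer fps_X ?q m ^ 2 * (?q ^ m * ?v m)"
      unfolding S_term_def
      by (subst fps_divide_unit) (simp_all only: q_pochhammer_denominator_unit power_mult mult.assoc, simp)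
    also have "\<dots> = (\<Sum>k=-int m..int m. ?t m k)"
      unfolding theta by (simp only: sum_distrib_right mult.assoc)
    also have "\<dots> = (\<Sum>k=-int M..int M. ?t m k)"
    proof (rule sum.mono_neutral_left)
      show "\<forall>k\<in>{-int M..int M} - {-int m..int m}. ?t m k = 0"
      proof
        fix k assume "k \<in> {-int M..int M} - {-int m..int m}"
        then have "2 * m < m + nat \<bar>k\<bar>"
          by auto
        then show "?t m k = 0"
          by (simp only: qbinom_eq_0 mult_zero_left mult_zero_right)
      qed
    qed (use that in auto)
    finally show ?thesis .
  qed
  then have "(\<Sum>m<M. S_term m) = (\<Sum>m<M. \<Sum>k=-int M..int M. ?t m k)"
    by (intro sum.cong) simp_all
  also have "\<dots> = (\<Sum>k=-int M..int M. \<Sum>m<M. ?t m k)"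
    by (rule sum.swap)
  finally show ?thesis
    by (simp only: gamma_partial_def sum_distrib_left)
qed

text \<open>
  Row \<open>k\<close> starts at an exponent of at least \<open>k\<^sup>2\<close>, hence only the rows with \<open>\<bar>k\<bar> \<le> n\<close> reach the
  coefficient of \<open>q\<^sup>n\<close>. For this finite set of rows, the limit of the partial sums can be taken row by
  row.
\<close>
theorem P_series_nth:
  "fps_nth P_series n = (\<Sum>k=-int n..int n. (-1) ^ nat \<bar>k\<bar> * fps_nth (hecke_row (nat \<bar>k\<bar>)) n)"
proof -
  let ?E = "q_pochhammer_inf (fps_X ^ 4) (fps_X ^ 4) :: complex fps"
  let ?h = "\<lambda>M k. fps_X ^ (nat \<bar>k\<bar>)\<^sup>2 * (?E * gamma_partial (fps_X\<^sup>2) M (nat \<bar>k\<bar>))"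
  have "(\<lambda>M. ?E * (\<Sum>m<M. S_term m)) \<longlonglongrightarrow> P_series"
    unfolding P_series_def using S_term_sums
    by (intro tendsto_mult_fps[OF tendsto_const]) (simp only: sums_def)
  then have P: "\<forall>\<^sub>F M in sequentially. fps_nth (?E * (\<Sum>m<M. S_term m)) n = fps_nth P_series n"
    by (simp only: tendsto_fps_iff)
  have "(\<lambda>M. ?h M k) \<longlonglongrightarrow> hecke_row (nat \<bar>k\<bar>)" for k :: int
    unfolding hecke_row_def by (intro tendsto_mult_fps[OF tendsto_const] gamma_row_tendsto)
  then have "\<forall>\<^sub>F M in sequentially. fps_nth (?h M k) n = fps_nth (hecke_row (nat \<bar>k\<bar>)) n" for k :: int
    by (simp only: tendsto_fps_iff)
  then have h: "\<forall>\<^sub>F M in sequentially. \<forall>k\<in>{-int n..int n}. fps_nth (?h M k) n = fps_nth (hecke_row (nat \<bar>k\<bar>)) n"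
    by (intro eventually_ball_finite) simp_all
  have "\<forall>\<^sub>F M in sequentially. fps_nth P_series n
      = (\<Sum>k=-int n..int n. (-1) ^ nat \<bar>k\<bar> * fps_nth (hecke_row (nat \<bar>k\<bar>)) n)"
    using P h eventually_ge_at_top[of n]
  proof eventually_elim
    case (elim M)
    have "?E * (\<Sum>m<M. S_term m) = (\<Sum>k=-int M..int M. (-1) ^ nat \<bar>k\<bar> * ?h M k)"
      unfolding sum_S_term by (simp only: sum_distrib_left mult_ac)
    moreover have "fps_nth ((-1) ^ l * f) n = (-1) ^ l * fps_nth f n" for l and f :: "complex fps"
      by (cases "even l") simp_all
    ultimately have "fps_nth P_series n = (\<Sum>k=-int M..int M. (-1) ^ nat \<bar>k\<bar> * fps_nth (?h M k) n)"
      using elim(1) by (simp only: fps_sum_nth)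
    also have "\<dots> = (\<Sum>k=-int n..int n. (-1) ^ nat \<bar>k\<bar> * fps_nth (?h M k) n)"
    proof (rule sum.mono_neutral_right)
      show "\<forall>k\<in>{-int M..int M} - {-int n..int n}. (-1) ^ nat \<bar>k\<bar> * fps_nth (?h M k) n = 0"
      proof
        fix k assume "k \<in> {-int M..int M} - {-int n..int n}"
        then have "n < nat \<bar>k\<bar>"
          by auto
        also have "nat \<bar>k\<bar> \<le> (nat \<bar>k\<bar>)\<^sup>2"
          by (simp only: power2_eq_square le_square)
        finally show "(-1) ^ nat \<bar>k\<bar> * fps_nth (?h M k) n = 0"
          by (simp only: fps_X_power_mult_nth if_True mult_zero_right)
      qed
    qed (use elim(3) in auto)
    also have "\<dots> = (\<Sum>k=-int n..int n. (-1) ^ nat \<bar>k\<bar> * fps_nth (hecke_row (nat \<bar>k\<bar>)) n)"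
      using elim(2) by (intro sum.cong) simp_all
    finally show ?case .
  qed
  then show ?thesis
    by simp
qed

theorem theorem1:
  shows "sieve 8 4 P_series = 0 \<and> (\<forall>n. n mod 8 = 4 \<longrightarrow> fps_nth P_series n = 0)"
proof -
  have "fps_nth P_series n = 0" if n: "n mod 8 = 4" for n
  proof -
    have "even n"
      using n by presburger
    then have "fps_nth (hecke_row k) n = 0" for k
      using n by (intro hecke_row_nth_eq_0) auto
    then show ?thesis
      by (simp add: P_series_nth)
  qed
  then show ?thesis
    by (auto simp: sieve_def fps_eq_iff)
qed

end
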